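(* Let $n \ge 1$ and $d$ be integers with $d > n$, and let $G$ be a finite simple $d$-regular graph with $2n$ vertices. Then $a'(G) \ge d+2 = \Delta(G)+2$.
   Context: All graphs are finite and simple. $\Delta(G)$ denotes the maximum degree of $G$. A proper edge coloring of a graph $G=(V,E)$ is a map $c:E\to C$ ($C$ a set of colors) with $c(e)\neq c(f)$ for any two distinct adjacent edges $e,f$ (edges sharing an endpoint). A proper edge coloring is acyclic if there is no bichromatic cycle, i.e. no cycle of $G$ whose edges use only two colors; equivalently, the union of any two color classes induces a linear forest (a disjoint union of paths). The acyclic chromatic index $a'(G)$ is the minimum number of colors in an acyclic edge coloring of $G$. *)

theory Defs
  imports Main
begin

definition simple_graph :: "'a set \<Rightarrow> 'a set set \<Rightarrow> bool" where
  "simple_graph V E \<longleftrightarrow> finite V \<and> (\<forall>e\<in>E. e \<subseteq> V \<and> card e = 2)"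

definition degree :: "'a set set \<Rightarrow> 'a \<Rightarrow> nat" where
  "degree E v = card {e \<in> E. v \<in> e}"

definition regular :: "'a set \<Rightarrow> 'a set set \<Rightarrow> nat \<Rightarrow> bool" where
  "regular V E d \<longleftrightarrow> (\<forall>v\<in>V. degree E v = d)"

definition max_degree :: "'a set \<Rightarrow> 'a set set \<Rightarrow> nat" where
  "max_degree V E = Max (degree E ` V)"

(* A cycle is given by its distinct vertices in cyclic order; the index is taken
   modulo the length so that the closing edge is included. *)
definition cycle_edges :: "'a list \<Rightarrow> 'a set set" where
  "cycle_edges xs = {{xs ! i, xs ! (Suc i mod length xs)} | i. i < length xs}"

definition is_cycle :: "'a set set \<Rightarrow> 'a list \<Rightarrow> bool" where
  "is_cycle E xs \<longleftrightarrow> 3 \<le> length xs \<and> distinct xs \<and> cycle_edges xs \<subseteq> E"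

definition proper_edge_coloring :: "'a set set \<Rightarrow> ('a set \<Rightarrow> 'c) \<Rightarrow> bool" where
  "proper_edge_coloring E c \<longleftrightarrow>
     (\<forall>e\<in>E. \<forall>f\<in>E. e \<noteq> f \<and> e \<inter> f \<noteq> {} \<longrightarrow> c e \<noteq> c f)"

definition bichromatic :: "('a set \<Rightarrow> 'c) \<Rightarrow> 'a list \<Rightarrow> bool" where
  "bichromatic c xs \<longleftrightarrow> (\<exists>a b. c ` cycle_edges xs \<subseteq> {a, b})"

definition acyclic_edge_coloring :: "'a set set \<Rightarrow> ('a set \<Rightarrow> 'c) \<Rightarrow> bool" where
  "acyclic_edge_coloring E c \<longleftrightarrow>
     proper_edge_coloring E c \<and> \<not> (\<exists>xs. is_cycle E xs \<and> bichromatic c xs)"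

(* Natural numbers suffice as colors because the edge sets considered are finite. *)
definition acyclic_chromatic_index :: "'a set set \<Rightarrow> nat" where
  "acyclic_chromatic_index E =
     (LEAST k. \<exists>c :: 'a set \<Rightarrow> nat. acyclic_edge_coloring E c \<and> card (c ` E) = k)"

lemma simple_graph_finite_edges:
  assumes "simple_graph V E"
  shows "finite E"
proof (rule finite_subset)
  show "E \<subseteq> Pow V" using assms by (auto simp: simple_graph_def)
  show "finite (Pow V)" using assms by (simp add: simple_graph_def)
qed

lemma inj_on_acyclic_edge_coloring:
  assumes inj: "inj_on c E"
  shows "acyclic_edge_coloring E c"
proof -
  have "\<not> bichromatic c xs" if cyc: "is_cycle E xs" for xs
  proof
    assume "bichromatic c xs"
    then obtain a b where ab: "c ` cycle_edges xs \<subseteq> {a, b}"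
      by (auto simp: bichromatic_def)
    from cyc have len: "3 \<le> length xs" and dist: "distinct xs"
      and sub: "cycle_edges xs \<subseteq> E"
      by (auto simp: is_cycle_def)
    have l: "0 < length xs" "Suc 0 < length xs" "2 < length xs" using len by auto
    let ?j = "Suc 2 mod length xs"
    have j: "?j < length xs" "?j \<noteq> 1" "?j \<noteq> 2"
      using len by (cases "length xs = 3"; simp)+
    have e: "{xs ! 0, xs ! 1} \<in> cycle_edges xs" "{xs ! 1, xs ! 2} \<in> cycle_edges xs"
        "{xs ! 2, xs ! ?j} \<in> cycle_edges xs"
      using len unfolding cycle_edges_def
      by (intro CollectI exI[of _ 0] exI[of _ 1] exI[of _ 2]; force simp: numeral_2_eq_2)+
    have n: "xs ! 0 \<noteq> xs ! 1" "xs ! 1 \<noteq> xs ! 2" "xs ! 0 \<noteq> xs ! 2"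
        "xs ! ?j \<noteq> xs ! 1" "xs ! ?j \<noteq> xs ! 2"
      using l j by (simp_all add: nth_eq_iff_index_eq[OF dist])
    have "{xs ! 0, xs ! 1} \<noteq> {xs ! 1, xs ! 2}" "{xs ! 1, xs ! 2} \<noteq> {xs ! 2, xs ! ?j}"
        "{xs ! 0, xs ! 1} \<noteq> {xs ! 2, xs ! ?j}"
      using n by (metis doubleton_eq_iff)+
    then have "c {xs ! 0, xs ! 1} \<noteq> c {xs ! 1, xs ! 2}"
        "c {xs ! 1, xs ! 2} \<noteq> c {xs ! 2, xs ! ?j}"
        "c {xs ! 0, xs ! 1} \<noteq> c {xs ! 2, xs ! ?j}"
      using inj e sub by (meson inj_onD subsetD)+
    moreover have "c {xs ! 0, xs ! 1} \<in> {a, b}" "c {xs ! 1, xs ! 2} \<in> {a, b}"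
        "c {xs ! 2, xs ! ?j} \<in> {a, b}"
      using e ab by blast+
    ultimately show False by auto
  qed
  moreover have "proper_edge_coloring E c"
    using inj by (auto simp: proper_edge_coloring_def inj_on_def)
  ultimately show ?thesis by (auto simp: acyclic_edge_coloring_def)
qed

lemma acyclic_chromatic_index_attained:
  assumes "finite E"
  shows "\<exists>c :: 'a set \<Rightarrow> nat. acyclic_edge_coloring E c \<and> card (c ` E) = acyclic_chromatic_index E"
proof -
  obtain c :: "'a set \<Rightarrow> nat" where "inj_on c E"
    using finite_imp_inj_to_nat_seg[OF assms] by blast
  then have "\<exists>k. \<exists>c :: 'a set \<Rightarrow> nat. acyclic_edge_coloring E c \<and> card (c ` E) = k"
    using inj_on_acyclic_edge_coloring by blast
  then show ?thesis unfolding acyclic_chromatic_index_def by (rule LeastI_ex)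
qed

end

theory Submission
  imports Defs
begin

text \<open>
  Why the bound holds.  In a proper edge coloring every color class is a matching, so it has at
  most \<open>n\<close> edges, and it has exactly \<open>n\<close> only if it covers all \<open>2 * n\<close> vertices.  Two classes
  covering all vertices would together form a 2-regular graph, which contains a cycle
  (\<open>min_degree_2_imp_cycle\<close>), and that cycle is bichromatic.  Hence in an acyclic coloring at most
  one class has \<open>n\<close> edges and every other class has at most \<open>n - 1\<close>.  With only \<open>d + 1\<close> colors
  this leaves room for at most \<open>(d + 1) * (n - 1) + 1 = d * n - (d - n)\<close> edges, fewer than the
  \<open>d * n\<close> edges that a \<open>d\<close>-regular graph has, because \<open>d > n\<close>.
\<close>

lemma simple_graph_edgeE:
  assumes "simple_graph V E" "e \<in> E" "x \<in> e"
  obtains y where "e = {x, y}" "x \<noteq> y" "y \<in> V"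
proof -
  have "card e = 2" "e \<subseteq> V" using assms by (auto simp: simple_graph_def)
  then obtain u w where "e = {u, w}" "u \<noteq> w" by (auto simp: card_2_iff)
  then show thesis using that[of u] that[of w] \<open>x \<in> e\<close> \<open>e \<subseteq> V\<close> by (auto simp: insert_commute)
qed

text \<open>
  The first vertex of a longest path has a neighbour other than its successor on the path.  That
  neighbour lies on the path, since otherwise the path could be extended, and so it closes an
  initial segment of the path to a cycle.
\<close>

lemma min_degree_2_imp_cycle:
  assumes G: "simple_graph V E" and "V \<noteq> {}" and deg: "\<And>v. v \<in> V \<Longrightarrow> 2 \<le> degree E v"
  shows "\<exists>xs. is_cycle E xs"
proof -
  define path where
    "path xs \<longleftrightarrow> xs \<noteq> [] \<and> distinct xs \<and> set xs \<subseteq> V \<and> successively (\<lambda>x y. {x, y} \<in> E) xs" for xs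
  have "finite V" using G by (simp add: simple_graph_def)
  then have "length xs < Suc (card V)" if "path xs" for xs
    using that card_mono[of V "set xs"] by (simp add: path_def distinct_card)
  moreover obtain v where "v \<in> V" using \<open>V \<noteq> {}\<close> by blast
  then have "path [v]" by (simp add: path_def)
  ultimately obtain xs where xs: "path xs" and max: "\<And>ys. path ys \<Longrightarrow> length ys \<le> length xs"
    using ex_has_greatest_nat[of path "[v]" length "Suc (card V)"] by auto
  \<comment> \<open>If the path is the single vertex \<open>x\<close>, then \<open>hd ys\<close> is an arbitrary element: excluding the set
    \<open>{x, hd ys}\<close> is then harmless, as \<open>x\<close> still has another edge.\<close>
  obtain x ys where xs_eq: "xs = x # ys" using xs by (cases xs) (auto simp: path_def)
  have "x \<in> V" using xs xs_eq by (simp add: path_def)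
  have "\<not> {e \<in> E. x \<in> e} \<subseteq> {{x, hd ys}}"
    using deg[OF \<open>x \<in> V\<close>] card_mono[of "{{x, hd ys}}" "{e \<in> E. x \<in> e}"]
    by (auto simp: degree_def)
  then obtain e where e: "e \<in> E" "x \<in> e" "e \<noteq> {x, hd ys}" by blast
  then obtain u where u: "e = {x, u}" "x \<noteq> u" "u \<in> V" using simple_graph_edgeE[OF G] by metis
  have "u \<in> set xs"
  proof (rule ccontr)
    assume "u \<notin> set xs"
    then have "path (u # xs)" using xs u e xs_eq by (auto simp: path_def insert_commute)
    then show False using max[of "u # xs"] by simp
  qed
  then obtain j where j: "j < length xs" "xs ! j = u" by (auto simp: in_set_conv_nth)
  have "j \<noteq> 0" using j u xs_eq by (cases j) auto
  moreover have "j \<noteq> 1" using j u e xs_eq by (cases ys) auto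
  ultimately have "2 \<le> j" by simp
  let ?C = "take (Suc j) xs"
  have len: "length ?C = Suc j" using j by simp
  have "{?C ! i, ?C ! (Suc i mod length ?C)} \<in> E" if "i < Suc j" for i
  proof (cases "i = j")
    case True
    moreover have "?C ! j = u" using j(2) by simp
    moreover have "?C ! 0 = x" using xs_eq by simp
    ultimately show ?thesis using len e u by (simp add: insert_commute)
  next
    case False
    then have "Suc i < length xs" "i < j" using that j by auto
    then show ?thesis using len xs by (simp add: path_def successively_conv_nth)
  qed
  then have "cycle_edges ?C \<subseteq> E" unfolding cycle_edges_def len by auto
  then have "is_cycle E ?C" using len \<open>2 \<le> j\<close> xs by (simp add: is_cycle_def path_def)
  then show ?thesis ..
qed

text \<open>Handshake identity: count the pairs of a vertex and an edge containing it in two ways.\<close>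

lemma regular_card_edges:
  assumes "simple_graph V E" "regular V E d"
  shows "card V * d = 2 * card E"
proof -
  have fin: "finite V" using assms by (simp add: simple_graph_def)
  have "{v \<in> V. v \<in> e} = e" "card e = 2" if "e \<in> E" for e
    using that assms by (auto simp: simple_graph_def)
  then have "(\<Sum>v\<in>V. card {e \<in> E. v \<in> e}) = 2 * card E"
    using fin simple_graph_finite_edges[OF assms(1)] by (intro sum_multicount) auto
  then show ?thesis using assms(2) by (simp add: regular_def degree_def)
qed

lemma card_Union_color_class:
  assumes "simple_graph V E" "proper_edge_coloring E c"
  shows "card (\<Union>{e \<in> E. c e = a}) = 2 * card {e \<in> E. c e = a}"
proof -
  have "card (\<Union>{e \<in> E. c e = a}) = sum card {e \<in> E. c e = a}"
  proof (rule card_Union_disjoint)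
    show "pairwise disjnt {e \<in> E. c e = a}"
      using assms(2) unfolding proper_edge_coloring_def pairwise_def disjnt_def by force
    show "finite e" if "e \<in> {e \<in> E. c e = a}" for e
      using that assms(1) by (auto simp: simple_graph_def intro: card_ge_0_finite)
  qed
  also have "\<dots> = 2 * card {e \<in> E. c e = a}"
    using assms(1) by (simp add: simple_graph_def)
  finally show ?thesis .
qed

text \<open>
  If two different colors each met every vertex, their edges would form a graph of minimum degree
  at least 2, in which any cycle is bichromatic.
\<close>

lemma spanning_color_class_unique:
  assumes G: "simple_graph V E" and "V \<noteq> {}" and c: "acyclic_edge_coloring E c"
    and a: "\<Union>{e \<in> E. c e = a} = V" and b: "\<Union>{e \<in> E. c e = b} = V"
  shows "a = b"
proof (rule ccontr)
  assume "a \<noteq> b"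
  let ?F = "{e \<in> E. c e \<in> {a, b}}"
  have F: "simple_graph V ?F" using G by (auto simp: simple_graph_def)
  have "2 \<le> degree ?F v" if v: "v \<in> V" for v
  proof -
    obtain e where e: "e \<in> E" "c e = a" "v \<in> e" using v a by blast
    obtain f where f: "f \<in> E" "c f = b" "v \<in> f" using v b by blast
    have "card {e, f} \<le> card {e \<in> ?F. v \<in> e}"
      using e f simple_graph_finite_edges[OF G] by (intro card_mono) auto
    moreover have "e \<noteq> f" using e f \<open>a \<noteq> b\<close> by auto
    ultimately show ?thesis by (simp add: degree_def)
  qed
  then obtain xs where "is_cycle ?F xs" using min_degree_2_imp_cycle[OF F \<open>V \<noteq> {}\<close>] by blast
  then have "is_cycle E xs" "c ` cycle_edges xs \<subseteq> {a, b}" by (auto simp: is_cycle_def)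
  then show False using c unfolding acyclic_edge_coloring_def bichromatic_def by blast
qed

text \<open>
  A color class with \<open>n\<close> edges is a matching that meets all \<open>2 * n\<close> vertices, so at most one class
  exceeds \<open>n - 1\<close> edges; that class accounts for the summand 1.
\<close>

lemma acyclic_edge_coloring_card_edges:
  assumes G: "simple_graph V E" and V: "card V = 2 * n" "n \<ge> 1" and c: "acyclic_edge_coloring E c"
  shows "card E \<le> card (c ` E) * (n - 1) + 1"
proof -
  let ?M = "\<lambda>a. {e \<in> E. c e = a}"
  let ?P = "{a \<in> c ` E. card (?M a) = n}"
  have fin: "finite V" "finite E" "V \<noteq> {}"
    using G V simple_graph_finite_edges by (auto simp: simple_graph_def)
  have proper: "proper_edge_coloring E c" using c by (simp add: acyclic_edge_coloring_def)
  have sub: "\<Union>(?M a) \<subseteq> V" for a using G by (auto simp: simple_graph_def)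
  have size: "card (\<Union>(?M a)) = 2 * card (?M a)" for a by (rule card_Union_color_class[OF G proper])
  have le: "card (?M a) \<le> n" for a
    using card_mono[OF fin(1) sub[of a]] size[of a] V by simp
  have "\<Union>(?M a) = V" if "card (?M a) = n" for a
    using card_subset_eq[OF fin(1) sub[of a]] size[of a] V that by simp
  then have unique: "a = b" if "a \<in> ?P" "b \<in> ?P" for a b
    using that by (intro spanning_color_class_unique[OF G fin(3) c]) simp_all
  have "finite ?P" using fin by simp
  then have "card ?P \<le> Suc 0" by (rule card_le_Suc0_iff_eq[THEN iffD2]) (intro ballI unique)
  then have P: "card ?P \<le> 1" by simp
  have "card E = (\<Sum>a\<in>c ` E. card (?M a))"
    using sum.image_gen[OF fin(2), of "\<lambda>_. 1::nat" c] by simp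
  also have "\<dots> \<le> (\<Sum>a\<in>c ` E. (n - 1) + (if card (?M a) = n then 1 else 0))"
  proof (rule sum_mono)
    fix a
    show "card (?M a) \<le> (n - 1) + (if card (?M a) = n then 1 else 0)"
      using le[of a] by auto
  qed
  also have "\<dots> = card (c ` E) * (n - 1) + card ?P"
    using fin by (simp add: sum.distrib sum.If_cases Int_def conj_commute)
  finally show ?thesis using P by linarith
qed

theorem theorem1:
  fixes V :: "'a set" and E :: "'a set set" and n d :: nat
  assumes "n \<ge> 1" and "d > n"
    and "simple_graph V E" and "regular V E d" and "card V = 2 * n"
  shows "acyclic_chromatic_index E \<ge> d + 2 \<and> d + 2 = max_degree V E + 2"
proof
  obtain c :: "'a set \<Rightarrow> nat"
    where c: "acyclic_edge_coloring E c" "card (c ` E) = acyclic_chromatic_index E"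
    using acyclic_chromatic_index_attained simple_graph_finite_edges assms(3) by blast
  have edges: "card E = n * d" using regular_card_edges[OF assms(3,4)] assms(5) by simp
  show "d + 2 \<le> acyclic_chromatic_index E"
  proof (rule ccontr)
    assume "\<not> d + 2 \<le> acyclic_chromatic_index E"
    then have "card (c ` E) * (n - 1) \<le> (d + 1) * (n - 1)" using c by (intro mult_right_mono) auto
    then have "n * d \<le> (d + 1) * (n - 1) + 1"
      using acyclic_edge_coloring_card_edges[OF assms(3,5,1) c(1)] edges by linarith
    \<comment> \<open>Writing \<open>n = Suc m\<close> removes the truncated subtraction and leaves \<open>d \<le> n\<close>.\<close>
    moreover obtain m where "n = Suc m" using \<open>n \<ge> 1\<close> by (cases n) auto
    ultimately show False using \<open>d > n\<close> by (simp add: algebra_simps)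
  qed
  have "V \<noteq> {}" using assms(1,5) by auto
  moreover have "degree E v = d" if "v \<in> V" for v using that assms(4) by (simp add: regular_def)
  ultimately have "degree E ` V = {d}" by auto
  then show "d + 2 = max_degree V E + 2" by (simp add: max_degree_def)
qed

end
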